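(* Let $\phi$ be a 2-uniform unique-sink orientation of the $n$-cube. Then the length (number of edges) of every directed path in $\phi$ is at most $2n$.
   Context: Notation: $[n]=\{1,\dots,n\}$. For $v\in\{0,1\}^n$ and $I\subseteq[n]$, $v\oplus I$ is $v$ with all entries with coordinates in $I$ flipped; $v\oplus i:=v\oplus\{i\}$. The $n$-cube is the graph on $\{0,1\}^n$ with edges $\{v,v\oplus i\}$, $i\in[n]$; a subcube is an induced subgraph on a vertex set $\{v\oplus I: I\subseteq C\}$, for a vertex $v$ and $C\subseteq[n]$. An orientation $\phi$ of the $n$-cube is a unique-sink orientation (USO) if every nonempty subcube has a unique sink in $\phi$. Write $v\to v\oplus i$ for a directed edge. A USO $\phi$ is 2-up-uniform if for every vertex $u$ and distinct $i,j\in[n]$ with $u_i=u_j=0$ such that $u$ is the source of the subcube on $\{u\oplus I: I\subseteq\{i,j\}\}$ (i.e. $u\to u\oplus i$ and $u\to u\oplus j$), the orientation of this subcube is uniform, i.e. all its edges are directed from the endpoint with entry $0$ to the endpoint with entry $1$ in the coordinate in which they differ (so also $u\oplus i\to u\oplus\{i,j\}$ and $u\oplus j\to u\oplus\{i,j\}$). A USO $\phi$ is 2-uniform if both $\phi$ and the orientation $\phi^{([n])}$ obtained from $\phi$ by reversing all edges (which is again a USO) are 2-up-uniform. *)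

theory Defs
  imports "HOL-Library.FuncSet" "Graph_Theory.Pair_Digraph"
begin

text \<open>Vertices are 0/1-vectors with entries indexed by $1,\dots,n$, where \<open>True\<close> stands for $1$ and
  \<open>False\<close> for $0$. They are extensional functions, so vectors are equal iff all their entries agree.\<close>

type_synonym vertex = "nat \<Rightarrow> bool"

definition cube_verts :: "nat \<Rightarrow> vertex set" where
  "cube_verts n = {1..n} \<rightarrow>\<^sub>E UNIV"

definition flip :: "vertex \<Rightarrow> nat set \<Rightarrow> vertex" where
  "flip v I = (\<lambda>k. if k \<in> I then \<not> v k else v k)"

text \<open>The undirected edge $\{v, v \oplus i\}$ is represented by both of its ordered pairs.\<close>

definition cube_edges :: "nat \<Rightarrow> vertex rel" where
  "cube_edges n = {(v, flip v {i}) | v i. v \<in> cube_verts n \<and> i \<in> {1..n}}"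

definition subcube :: "vertex \<Rightarrow> nat set \<Rightarrow> vertex set" where
  "subcube v C = {flip v I | I. I \<subseteq> C}"

text \<open>An orientation is given by its set of directed edges: \<open>(u, v) \<in> \<phi>\<close> means $u \to v$. Reversing
  all edges is the relational converse.\<close>

definition is_orientation :: "nat \<Rightarrow> vertex rel \<Rightarrow> bool" where
  "is_orientation n \<phi> \<longleftrightarrow>
     \<phi> \<subseteq> cube_edges n \<and> (\<forall>(u, v) \<in> cube_edges n. (u, v) \<in> \<phi> \<longleftrightarrow> (v, u) \<notin> \<phi>)"

definition is_sink :: "vertex rel \<Rightarrow> vertex set \<Rightarrow> vertex \<Rightarrow> bool" where
  "is_sink \<phi> S w \<longleftrightarrow> w \<in> S \<and> (\<forall>x\<in>S. (w, x) \<notin> \<phi>)"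

definition is_uso :: "nat \<Rightarrow> vertex rel \<Rightarrow> bool" where
  "is_uso n \<phi> \<longleftrightarrow> is_orientation n \<phi> \<and>
     (\<forall>v \<in> cube_verts n. \<forall>C \<subseteq> {1..n}. \<exists>!w. is_sink \<phi> (subcube v C) w)"

definition uniform_on :: "nat \<Rightarrow> vertex rel \<Rightarrow> vertex set \<Rightarrow> bool" where
  "uniform_on n \<phi> S \<longleftrightarrow>
     (\<forall>v \<in> S. \<forall>i \<in> {1..n}. flip v {i} \<in> S \<and> \<not> v i \<longrightarrow> (v, flip v {i}) \<in> \<phi>)"

definition two_up_uniform :: "nat \<Rightarrow> vertex rel \<Rightarrow> bool" where
  "two_up_uniform n \<phi> \<longleftrightarrow>
     (\<forall>u \<in> cube_verts n. \<forall>i \<in> {1..n}. \<forall>j \<in> {1..n}.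
        i \<noteq> j \<and> \<not> u i \<and> \<not> u j \<and> (u, flip u {i}) \<in> \<phi> \<and> (u, flip u {j}) \<in> \<phi>
        \<longrightarrow> uniform_on n \<phi> (subcube u {i, j}))"

text \<open>The converse of a unique-sink orientation is always a unique-sink orientation, so this need
  not be required separately.\<close>

definition two_uniform_uso :: "nat \<Rightarrow> vertex rel \<Rightarrow> bool" where
  "two_uniform_uso n \<phi> \<longleftrightarrow> is_uso n \<phi> \<and> two_up_uniform n \<phi> \<and> two_up_uniform n (\<phi>\<inverse>)"

definition oriented_cube :: "nat \<Rightarrow> vertex rel \<Rightarrow> vertex pair_pre_digraph" where
  "oriented_cube n \<phi> = \<lparr>pverts = cube_verts n, parcs = \<phi>\<rparr>"

end

theory Submission
  imports Defs
begin

text \<open>Once a coordinate has been flipped from 0 to 1 along a directed path, it is never flipped back: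
  on the 2-faces spanned by \<open>i\<close> and any other coordinate, 2-uniformity and acyclicity
  force the entry 1 with incoming edge in coordinate \<open>i\<close> to persist along outgoing edges.
  Hence every coordinate is flipped at most twice, first from 1 to 0 and then from 0 to 1.\<close>

lemma flip_flip_singleton [simp]: "flip (flip v {i}) {i} = v"
  by (simp add: flip_def fun_eq_iff)

lemma flip_commute: "flip (flip v I) J = flip (flip v J) I"
  by (auto simp: flip_def fun_eq_iff)

lemma flip_in_cube_verts:
  "v \<in> cube_verts n \<Longrightarrow> i \<in> {1..n} \<Longrightarrow> flip v {i} \<in> cube_verts n"
  by (auto simp: cube_verts_def flip_def PiE_iff extensional_def)

text \<open>The last vertex is written as two single flips, because edges are given by single
  flips.\<close>

lemma subcube_pair:
  "subcube v {i, j} = {v, flip v {i}, flip v {j}, flip (flip v {i}) {j}}"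
  if "i \<noteq> j"
proof -
  have "subcube v {i, j} = flip v ` Pow {i, j}"
    unfolding subcube_def by blast
  also have "\<dots> = {flip v {}, flip v {i}, flip v {j}, flip v {i, j}}"
    by (auto simp: Pow_insert)
  finally have "subcube v {i, j} = {flip v {}, flip v {i}, flip v {j}, flip v {i, j}}" .
  moreover have "flip (flip v {i}) {j} = flip v {i, j}"
    using that by (auto simp: flip_def fun_eq_iff)
  ultimately show ?thesis
    by (simp add: flip_def)
qed

lemma orientation_antisym:
  assumes "is_orientation n \<phi>" "(u, v) \<in> \<phi>"
  shows "(v, u) \<notin> \<phi>"
  using assms unfolding is_orientation_def by fast

lemma orientation_total:
  assumes "is_orientation n \<phi>" "v \<in> cube_verts n" "i \<in> {1..n}"
  shows "(v, flip v {i}) \<in> \<phi> \<or> (flip v {i}, v) \<in> \<phi>"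
proof -
  have "(v, flip v {i}) \<in> cube_edges n"
    using assms(2,3) unfolding cube_edges_def by blast
  then show ?thesis
    using assms(1) unfolding is_orientation_def by blast
qed

lemma orientation_edgeE:
  assumes "is_orientation n \<phi>" "(u, v) \<in> \<phi>"
  obtains j where "u \<in> cube_verts n" "j \<in> {1..n}" "v = flip u {j}"
proof -
  have "(u, v) \<in> cube_edges n"
    using assms unfolding is_orientation_def by blast
  then show ?thesis
    using that unfolding cube_edges_def by blast
qed

lemma two_up_uniformD:
  assumes "two_up_uniform n \<phi>" "u \<in> cube_verts n" "i \<in> {1..n}" "j \<in> {1..n}" "i \<noteq> j"
    and "\<not> u i" "\<not> u j" "(u, flip u {i}) \<in> \<phi>" "(u, flip u {j}) \<in> \<phi>"
  shows "(flip u {j}, flip (flip u {j}) {i}) \<in> \<phi>"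
proof -
  have "uniform_on n \<phi> (subcube u {i, j})"
    using assms unfolding two_up_uniform_def by blast
  moreover have "\<not> flip u {j} i"
    using assms by (simp add: flip_def)
  ultimately show ?thesis
    using assms(3,5) unfolding uniform_on_def
    by (auto simp: subcube_pair flip_commute[of u "{j}"])
qed

text \<open>A directed 4-cycle around a 2-face would give each of its four vertices an outgoing
  edge, so the face would have no sink.\<close>

lemma uso_face_acyclic:
  assumes "is_uso n \<phi>" "v \<in> cube_verts n" "i \<in> {1..n}" "j \<in> {1..n}" "i \<noteq> j"
    and "(v, flip v {i}) \<in> \<phi>" "(flip v {i}, flip (flip v {i}) {j}) \<in> \<phi>"
    and "(flip (flip v {i}) {j}, flip v {j}) \<in> \<phi>"
  shows "(flip v {j}, v) \<notin> \<phi>"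
proof
  assume "(flip v {j}, v) \<in> \<phi>"
  moreover obtain w where "is_sink \<phi> (subcube v {i, j}) w"
    using assms(1-4) unfolding is_uso_def by blast
  ultimately show False
    using assms(5-8) by (auto simp: is_sink_def subcube_pair)
qed

lemma one_incoming_persists:
  assumes "two_uniform_uso n \<phi>" "u \<in> cube_verts n" "i \<in> {1..n}" "j \<in> {1..n}" "i \<noteq> j"
    and "u i" "(flip u {i}, u) \<in> \<phi>" "(u, flip u {j}) \<in> \<phi>"
  shows "(flip (flip u {j}) {i}, flip u {j}) \<in> \<phi>"
proof (rule ccontr)
  \<comment> \<open>The 2-face has the vertices \<open>d\<close>, \<open>u\<close>,
    \<open>flip u {j}\<close>, \<open>c\<close> in cyclic order; \<open>d\<close> and
    \<open>c\<close> are those with entry 0 in coordinate \<open>i\<close>.\<close>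
  define d where "d = flip u {i}"
  define c where "c = flip (flip u {j}) {i}"
  have uso: "is_uso n \<phi>" and up: "two_up_uniform n \<phi>" and down: "two_up_uniform n (\<phi>\<inverse>)"
    using assms(1) by (auto simp: two_uniform_uso_def)
  then have ori: "is_orientation n \<phi>"
    by (simp add: is_uso_def)
  have d: "d \<in> cube_verts n" and c: "c \<in> cube_verts n"
    using assms(2-4) by (simp_all only: c_def d_def flip_in_cube_verts)
  have du: "(d, u) \<in> \<phi>"
    using assms(7) by (simp add: d_def)
  have flips: "flip d {i} = u" "flip d {j} = c" "flip c {i} = flip u {j}" "flip c {j} = d"
    by (auto simp: c_def d_def flip_def fun_eq_iff)
  assume "(flip (flip u {j}) {i}, flip u {j}) \<notin> \<phi>"
  then have bc: "(flip u {j}, c) \<in> \<phi>"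
    using orientation_total[OF ori flip_in_cube_verts[OF assms(2,4)] assms(3)]
    unfolding c_def by blast
  \<comment> \<open>The negated claim yields the directed path from \<open>d\<close> via
    \<open>u\<close> and \<open>flip u {j}\<close> to \<open>c\<close>, which an edge from
    \<open>c\<close> to \<open>d\<close> would close to a cycle. So \<open>d\<close> is the source
    and \<open>c\<close> the sink of the face.\<close>
  have "(c, d) \<notin> \<phi>"
    using uso_face_acyclic[OF uso d assms(3-5)] du assms(8) bc unfolding flips by blast
  then have dc: "(d, c) \<in> \<phi>"
    using orientation_total[OF ori d assms(4)] unfolding flips by blast
  have di: "\<not> d i" and ci: "\<not> c i"
    using assms(5,6) by (auto simp: d_def c_def flip_def)
  show False
  proof (cases "u j")
    case False
    \<comment> \<open>Here the source \<open>d\<close> is the bottom vertex of the face, so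
      uniformity directs the edge between \<open>c\<close> and \<open>flip u {j}\<close> upwards,
      out of \<open>c\<close>.\<close>
    then have "\<not> d j"
      using assms(5) by (simp add: d_def flip_def)
    then have "(c, flip u {j}) \<in> \<phi>"
      using two_up_uniformD[OF up d assms(3-5) di] dc du unfolding flips by blast
    then show False
      using bc orientation_antisym[OF ori] by blast
  next
    case True
    \<comment> \<open>Now the sink \<open>c\<close> is the bottom vertex. It is the source after
      reversal, and uniformity of the reversed face turns the edge from \<open>d\<close> to
      \<open>u\<close> around.\<close>
    then have "\<not> c j"
      using assms(5) by (simp add: c_def flip_def)
    then have "(d, u) \<in> \<phi>\<inverse>"
      using two_up_uniformD[OF down c assms(3-5) ci] dc bc unfolding flips by blast
    then show False
      using du orientation_antisym[OF ori] by blast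
  qed
qed

text \<open>An upper bound for the number of times that coordinate \<open>i\<close> is flipped on a path from \<open>u\<close>.\<close>

definition flip_bound :: "vertex rel \<Rightarrow> vertex \<Rightarrow> nat \<Rightarrow> nat" where
  "flip_bound \<phi> u i = (if u i then if (flip u {i}, u) \<in> \<phi> then 0 else 2 else 1)"

lemma flip_bound_le_2: "flip_bound \<phi> u i \<le> 2"
  by (simp add: flip_bound_def)

text \<open>From entry 1 the value drops from 2 to 1, since an outgoing edge excludes the value 0.
  From entry 0 it drops from 1 to 0, since the edge just used enters the new entry 1.\<close>

lemma flip_bound_edge_same:
  assumes "is_orientation n \<phi>" "(u, flip u {i}) \<in> \<phi>"
  shows "flip_bound \<phi> (flip u {i}) i < flip_bound \<phi> u i"
  using assms orientation_antisym[OF assms] by (simp add: flip_bound_def) (simp add: flip_def)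

text \<open>Entry \<open>i\<close> does not change, so the value could only grow from 0 to 2, by
  losing the incoming edge at an entry 1; \<open>one_incoming_persists\<close> excludes
  this.\<close>

lemma flip_bound_edge_other:
  assumes "two_uniform_uso n \<phi>" "u \<in> cube_verts n" "i \<in> {1..n}" "j \<in> {1..n}" "i \<noteq> j"
    and "(u, flip u {j}) \<in> \<phi>"
  shows "flip_bound \<phi> (flip u {j}) i \<le> flip_bound \<phi> u i"
proof -
  have "flip u {j} i = u i"
    using assms(5) by (simp add: flip_def)
  then show ?thesis
    using one_incoming_persists[OF assms(1-5) _ _ assms(6)] by (simp add: flip_bound_def)
qed

text \<open>The sum serves as a potential: the summand of the flipped coordinate drops and no other
  summand grows.\<close>

lemma sum_flip_bound_edge:
  assumes "two_uniform_uso n \<phi>" "(u, v) \<in> \<phi>"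
  shows "(\<Sum>i = 1..n. flip_bound \<phi> v i) < (\<Sum>i = 1..n. flip_bound \<phi> u i)"
proof -
  have ori: "is_orientation n \<phi>"
    using assms(1) by (simp add: two_uniform_uso_def is_uso_def)
  obtain j where j: "u \<in> cube_verts n" "j \<in> {1..n}" "v = flip u {j}"
    using orientation_edgeE[OF ori assms(2)] .
  have less: "flip_bound \<phi> v j < flip_bound \<phi> u j"
    using flip_bound_edge_same[OF ori] assms(2) j by simp
  show ?thesis
  proof (rule sum_strict_mono_ex1)
    show "\<forall>i\<in>{1..n}. flip_bound \<phi> v i \<le> flip_bound \<phi> u i"
      using flip_bound_edge_other[OF assms(1) j(1) _ j(2)] assms(2) j(3) less
      by (metis less_imp_le)
    show "\<exists>i\<in>{1..n}. flip_bound \<phi> v i < flip_bound \<phi> u i"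
      using j(2) less by blast
  qed simp
qed

text \<open>Each arc uses up at least one unit of the potential. The start vertex varies in the
  induction, as the tail of the walk starts at the head of its first arc.\<close>

lemma walk_length_le_sum_flip_bound:
  assumes "two_uniform_uso n \<phi>" "set p \<subseteq> \<phi>"
    and "pre_digraph.cas (with_proj (oriented_cube n \<phi>)) u p v"
  shows "length p \<le> (\<Sum>i = 1..n. flip_bound \<phi> u i)"
  using assms(2,3)
proof (induction p arbitrary: u)
  case Nil
  then show ?case by simp
next
  case (Cons e p)
  have "fst e = u" "pre_digraph.cas (with_proj (oriented_cube n \<phi>)) (snd e) p v"
    using Cons.prems(2) by (simp_all add: pre_digraph.cas.simps)
  moreover from this have "(u, snd e) \<in> \<phi>"
    using Cons.prems(1) by auto
  ultimately show ?case
    using Cons.IH[of "snd e"] Cons.prems(1) sum_flip_bound_edge[OF assms(1)] by fastforce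
qed

theorem theorem5p9:
  fixes n :: nat and \<phi> :: "vertex rel" and u v :: vertex and p :: "(vertex \<times> vertex) awalk"
  assumes "two_uniform_uso n \<phi>"
    and "pre_digraph.apath (with_proj (oriented_cube n \<phi>)) u p v"
  shows "length p \<le> 2 * n"
proof -
  have "set p \<subseteq> \<phi>" "pre_digraph.cas (with_proj (oriented_cube n \<phi>)) u p v"
    using assms(2)
    by (auto simp: pre_digraph.apath_def pre_digraph.awalk_def oriented_cube_def)
  then have "length p \<le> (\<Sum>i = 1..n. flip_bound \<phi> u i)"
    using walk_length_le_sum_flip_bound[OF assms(1)] by blast
  also have "\<dots> \<le> 2 * n"
    using sum_bounded_above[of "{1..n}" "flip_bound \<phi> u" 2] by (simp add: flip_bound_le_2)
  finally show ?thesis .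
qed

end
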